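(* Let $n\ge 2$ and let $0<W_1<W_2<\dots<W_n<1$ be the weights of $n$ marbles, with mean $m=\frac{1}{n}\sum_{i=1}^n W_i$. A pair of distinct marbles is drawn uniformly at random among all $\binom n2$ pairs; one marble of the pair is chosen with probability $1/2$ each and examined. Let $X$ be the weight of the examined marble and $U$ the weight of the other (unexamined) marble of the pair. Let $r$ be uniformly distributed on $(0,1)$, independent of these choices. The unexamined marble is assigned to the set $A$ (written $U\to A$) if $r<X$, and to the set $B$ (written $U\to B$) if $r>X$. Then $$E(U\to A)<m<E(U\to B).$$
   Context: $E(U\to A)$ denotes the expected weight of an unexamined marble assigned to $A$: writing $P(U\to A)$ for the probability that the unexamined marble is assigned to $A$ and $W(U\to A)=\mathbb{E}[U\cdot \mathbf 1_{\{U\to A\}}]$, one sets $E(U\to A)=W(U\to A)/P(U\to A)$, i.e. the conditional expectation of $U$ given that it is assigned to $A$. $P(U\to B)$, $W(U\to B)$ and $E(U\to B)$ are defined in the same way with $B$ in place of $A$. *)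

theory Defs
  imports "HOL-Probability.Probability"
begin

text \<open>
  The law of (index of the examined marble, index of the unexamined marble):
  first a uniformly random two-element set of marbles, then a fair choice of which of the
  two is examined.  The marbles are indexed by \<open>{1..n}\<close>, and \<open>2 \<le> n\<close> is needed for
  the set of pairs to be nonempty.
\<close>

definition draw_pmf :: "nat \<Rightarrow> (nat \<times> nat) pmf" where
  "draw_pmf n =
     bind_pmf (pmf_of_set {S. S \<subseteq> {1..n} \<and> card S = 2})
       (\<lambda>S. map_pmf (\<lambda>i. (i, the_elem (S - {i}))) (pmf_of_set S))"

definition assigned_A :: "'a measure \<Rightarrow> ('a \<Rightarrow> real) \<Rightarrow> ('a \<Rightarrow> real) \<Rightarrow> 'a set" where
  "assigned_A M X r = {\<omega> \<in> space M. r \<omega> < X \<omega>}"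

definition assigned_B :: "'a measure \<Rightarrow> ('a \<Rightarrow> real) \<Rightarrow> ('a \<Rightarrow> real) \<Rightarrow> 'a set" where
  "assigned_B M X r = {\<omega> \<in> space M. r \<omega> > X \<omega>}"

text \<open>
  For an event \<open>F\<close> (the unexamined marble is assigned to \<open>A\<close>, respectively to \<open>B\<close>),
  the following are \<open>P(F)\<close>, \<open>W(F) = E[U 1\<^sub>F]\<close> and \<open>E(F) = W(F) / P(F)\<close>.
\<close>

definition assign_prob :: "'a measure \<Rightarrow> 'a set \<Rightarrow> real" where
  "assign_prob M F = measure M F"

definition assign_weight :: "'a measure \<Rightarrow> ('a \<Rightarrow> real) \<Rightarrow> 'a set \<Rightarrow> real" where
  "assign_weight M U F = (\<integral>\<omega>. U \<omega> * indicator F \<omega> \<partial>M)"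

definition assign_expect :: "'a measure \<Rightarrow> ('a \<Rightarrow> real) \<Rightarrow> 'a set \<Rightarrow> real" where
  "assign_expect M U F = assign_weight M U F / assign_prob M F"

end

theory Submission
  imports Defs
begin

text \<open>
  Conditioning on the draw, \<open>P(U \<rightarrow> A) = m\<close> and
  \<open>W(U \<rightarrow> A)\<close> is the average of \<open>W i * W j\<close> over \<open>i \<noteq> j\<close>, namely
  \<open>((n * m)\<^sup>2 - Q) / (n * (n - 1))\<close> where \<open>Q\<close> is the sum of the squared weights.
  Since the weights are not all equal, \<open>Q > n * m\<^sup>2\<close>, whence \<open>W(U \<rightarrow> A) < m\<^sup>2\<close>.
  Ties \<open>r = X\<close> are null, so \<open>P(U \<rightarrow> B) = 1 - m\<close> and
  \<open>W(U \<rightarrow> B) = m - W(U \<rightarrow> A) > m * (1 - m)\<close>.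
\<close>

text \<open>On a two-element set, sending the examined marble to the pair (examined, other) is
  injective, so the fair choice becomes the uniform law on the two orderings.\<close>

lemma pmf_examine_pair:
  assumes "card S = 2"
  shows "pmf (map_pmf (\<lambda>i. (i, the_elem (S - {i}))) (pmf_of_set S)) (i, j) =
         (if i \<noteq> j \<and> S = {i, j} then 1 / 2 else 0)"
proof -
  obtain a b where S: "S = {a, b}" "a \<noteq> b"
    using assms by (auto simp: card_2_iff)
  have diff: "{a, b} - {a} = {b}" "{a, b} - {b} = {a}" "insert a {b} - {b} = {a}"
    using S(2) by auto
  have "map_pmf (\<lambda>i. (i, the_elem (S - {i}))) (pmf_of_set S) = pmf_of_set ((\<lambda>i. (i, the_elem (S - {i}))) ` S)"
    using S by (intro map_pmf_of_set_inj) (auto simp: inj_on_def)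
  also have "(\<lambda>i. (i, the_elem (S - {i}))) ` S = {(a, b), (b, a)}"
    using S diff by simp
  finally show ?thesis
    using S by (auto simp: indicator_def doubleton_eq_iff)
qed

text \<open>An ordered pair of distinct marbles arises from exactly one unordered pair, so its
  probability is one half divided by \<open>n choose 2\<close>: the draw is uniform on ordered pairs
  off the diagonal.\<close>

lemma pmf_draw_pmf:
  assumes n: "n \<ge> 2"
  shows "pmf (draw_pmf n) (i, j) =
         (if i \<in> {1..n} \<and> j \<in> {1..n} \<and> i \<noteq> j then 1 / (real n * (real n - 1)) else 0)"
proof -
  define P where "P = {S. S \<subseteq> {1..n} \<and> card S = 2}"
  have fin: "finite P"
    unfolding P_def by (rule finite_subset[of _ "Pow {1..n}"]) auto
  have "{1, 2} \<in> P"
    using n by (auto simp: P_def)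
  then have ne: "P \<noteq> {}"
    by blast
  have "real (card P) = real (n choose 2)"
    unfolding P_def by (subst n_subsets) auto
  also have "\<dots> = real n * (real n - 1) / 2"
    using n by (simp add: choose_two real_of_nat_div of_nat_diff)
  finally have card: "real (card P) = real n * (real n - 1) / 2" .
  have "pmf (draw_pmf n) (i, j) = 
      (\<Sum>S\<in>P. pmf (map_pmf (\<lambda>i. (i, the_elem (S - {i}))) (pmf_of_set S)) (i, j)) / card P"
    unfolding draw_pmf_def P_def[symmetric] by (rule pmf_bind_pmf_of_set[OF ne fin])
  also have "(\<Sum>S\<in>P. pmf (map_pmf (\<lambda>i. (i, the_elem (S - {i}))) (pmf_of_set S)) (i, j)) =
      (\<Sum>S\<in>P. if S = {i, j} then (if i \<noteq> j then 1 / 2 else 0) else 0)"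
    by (intro sum.cong refl) (subst pmf_examine_pair, auto simp: P_def)
  also have "\<dots> = (if {i, j} \<in> P \<and> i \<noteq> j then 1 / 2 else 0)"
    using fin by (simp add: sum.delta)
  also have "{i, j} \<in> P \<and> i \<noteq> j \<longleftrightarrow> i \<in> {1..n} \<and> j \<in> {1..n} \<and> i \<noteq> j"
    by (auto simp: P_def card_insert_if)
  finally show ?thesis
    by (simp add: card)
qed

text \<open>This replaces a Fubini argument. Almost surely \<open>D\<close> takes values in a finite
  set, so the event splits into the disjoint pieces where \<open>D = d\<close>, and independence
  factorises the probability of each piece. The set \<open>T d\<close> may depend on
  \<open>d\<close>, which covers both \<open>r < X\<close> and \<open>r > X\<close>.\<close>

lemma (in prob_space) integral_indep_discrete:
  fixes g :: "'b::countable \<Rightarrow> real"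
  assumes D: "D \<in> measurable M (count_space UNIV)"
    and r: "r \<in> measurable M N"
    and indep: "indep_set (sets (vimage_algebra (space M) D (count_space UNIV)))
                  (sets (vimage_algebra (space M) r N))"
    and law: "distr M (count_space UNIV) D = measure_pmf p"
    and fin: "finite S" and supp: "set_pmf p \<subseteq> S"
    and T: "\<And>d. T d \<in> sets N"
  shows "(\<integral>\<omega>. g (D \<omega>) * indicator {\<omega> \<in> space M. r \<omega> \<in> T (D \<omega>)} \<omega> \<partial>M) =
         (\<Sum>d\<in>S. g d * (pmf p d * measure (distr M N r) (T d)))"
proof -
  define E where "E d = (D -` {d} \<inter> space M) \<inter> (r -` T d \<inter> space M)" for d
  have sD: "D -` {d} \<inter> space M \<in> sets M" for d
    using D by (rule measurable_sets) simp
  have sr: "r -` T d \<inter> space M \<in> sets M" for d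
    using r T by (rule measurable_sets)
  have E: "E d \<in> sets M" for d
    unfolding E_def using sD sr by blast
  have prob_E: "prob (E d) = pmf p d * measure (distr M N r) (T d)" for d
  proof -
    have "prob (E d) = prob (D -` {d} \<inter> space M) * prob (r -` T d \<inter> space M)"
      unfolding E_def using indep
      by (rule indep_setD) (auto intro!: in_vimage_algebra T)
    also have "prob (D -` {d} \<inter> space M) = measure (distr M (count_space UNIV) D) {d}"
      using D by (simp add: measure_distr)
    also have "\<dots> = pmf p d"
      by (simp add: law measure_pmf_single)
    also have "prob (r -` T d \<inter> space M) = measure (distr M N r) (T d)"
      using r T by (simp add: measure_distr)
    finally show ?thesis .
  qed
  have "AE d in measure_pmf p. d \<in> S"
    using supp by (auto simp: AE_measure_pmf_iff)
  then have "AE d in distr M (count_space UNIV) D. d \<in> S"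
    unfolding law .
  then have AE: "AE \<omega> in M. D \<omega> \<in> S"
    by (subst (asm) AE_distr_iff[OF D]) auto
  \<comment> \<open>Only the summand with \<open>d = D \<omega>\<close> survives. It is present only
    if \<open>D \<omega>\<close> lies in \<open>S\<close>, so the identity is used almost
    everywhere.\<close>
  have pointwise: "g (D \<omega>) * indicator {\<omega> \<in> space M. r \<omega> \<in> T (D \<omega>)} \<omega> =
      (\<Sum>d\<in>S. g d * indicator (E d) \<omega>)" if "D \<omega> \<in> S" "\<omega> \<in> space M" for \<omega>
  proof -
    have "(\<Sum>d\<in>S. g d * indicator (E d) \<omega>) =
        (\<Sum>d\<in>S. if d = D \<omega> then g d * indicator (T d) (r \<omega>) else 0)"
      using that by (intro sum.cong) (auto simp: E_def indicator_def)
    also have "\<dots> = g (D \<omega>) * indicator {\<omega> \<in> space M. r \<omega> \<in> T (D \<omega>)} \<omega>"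
      using that fin by (simp add: sum.delta indicator_def)
    finally show ?thesis ..
  qed
  \<comment> \<open>Measurability is needed for the whole event, so the union runs over all
    \<open>d\<close>, not just \<open>S\<close>; countability of the type enters here.\<close>
  have "{\<omega> \<in> space M. r \<omega> \<in> T (D \<omega>)} = (\<Union>d. E d)"
    by (auto simp: E_def)
  also have "\<dots> \<in> sets M"
    using E by (intro sets.countable_UN) auto
  finally have [measurable]: "{\<omega> \<in> space M. r \<omega> \<in> T (D \<omega>)} \<in> sets M" .
  have [measurable]: "(\<lambda>\<omega>. g (D \<omega>)) \<in> borel_measurable M"
    by (rule measurable_compose[OF D]) simp
  note [measurable] = E
  have int: "integrable M (\<lambda>\<omega>. g d * indicator (E d) \<omega>)" for d
    using E by (auto intro!: integrable_mult_right simp: emeasure_eq_measure)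
  have "(\<integral>\<omega>. g (D \<omega>) * indicator {\<omega> \<in> space M. r \<omega> \<in> T (D \<omega>)} \<omega> \<partial>M) =
      (\<integral>\<omega>. (\<Sum>d\<in>S. g d * indicator (E d) \<omega>) \<partial>M)"
    using AE pointwise by (intro integral_cong_AE) auto
  also have "\<dots> = (\<Sum>d\<in>S. \<integral>\<omega>. g d * indicator (E d) \<omega> \<partial>M)"
    by (rule Bochner_Integration.integral_sum) (rule int)
  also have "\<dots> = (\<Sum>d\<in>S. g d * (pmf p d * measure (distr M N r) (T d)))"
    using E by (intro sum.cong refl) (simp add: prob_E)
  finally show ?thesis .
qed


lemma measure_uniform_lessThan:
  assumes "0 < w" "w < (1::real)"
  shows "measure (uniform_measure lborel {0<..<1}) {..<w} = w"
proof -
  have "{0<..<1} \<inter> {..<w} = {0<..<w}"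
    using assms by auto
  then show ?thesis
    using assms by (subst measure_uniform_measure) auto
qed

lemma measure_uniform_greaterThan:
  assumes "0 < w" "w < (1::real)"
  shows "measure (uniform_measure lborel {0<..<1}) {w<..} = 1 - w"
proof -
  have "{0<..<1} \<inter> {w<..} = {w<..<1}"
    using assms by auto
  then show ?thesis
    using assms by (subst measure_uniform_measure) auto
qed

text \<open>The difference of the two sides is the sum of squared deviations from the mean, which is
  positive because two distinct values cannot both equal \<open>m\<close>.\<close>

lemma sum_squares_gt_mean:
  fixes f :: "'i \<Rightarrow> real"
  assumes fin: "finite I" and m: "m = (\<Sum>i\<in>I. f i) / card I"
    and ij: "i \<in> I" "j \<in> I" "f i \<noteq> f j"
  shows "real (card I) * m\<^sup>2 < (\<Sum>i\<in>I. (f i)\<^sup>2)"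
proof -
  have "card I > 0"
    using fin ij by (auto simp: card_gt_0_iff)
  then have S: "(\<Sum>i\<in>I. f i) = card I * m"
    by (simp add: m)
  obtain k where k: "k \<in> I" "f k \<noteq> m"
    using ij by metis
  have "0 < (\<Sum>i\<in>I. (f i - m)\<^sup>2)"
    using fin k by (intro sum_pos2[of _ k]) auto
  also have "\<dots> = (\<Sum>i\<in>I. (f i)\<^sup>2) - 2 * m * (\<Sum>i\<in>I. f i) + card I * m\<^sup>2"
    by (simp add: power2_diff sum.distrib sum_subtractf sum_distrib_left[symmetric] sum_distrib_right[symmetric] mult_ac)
  finally show ?thesis
    by (simp add: S power2_eq_square algebra_simps)
qed

text \<open>The sum over distinct indices is the full product minus the diagonal. Here
  \<open>u\<close> stands for the chance of assignment given the examined marble, and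
  \<open>v\<close> for the quantity averaged over the unexamined one.\<close>

lemma sum_times_draw_pmf:
  assumes n: "n \<ge> 2"
  shows "(\<Sum>d\<in>{1..n} \<times> {1..n}. v (snd d) * (pmf (draw_pmf n) d * u (fst d))) =
         ((\<Sum>i=1..n. u i) * (\<Sum>i=1..n. v i) - (\<Sum>i=1..n. u i * v i)) / (real n * (real n - 1))"
proof -
  have "(\<Sum>d\<in>{1..n} \<times> {1..n}. v (snd d) * (pmf (draw_pmf n) d * u (fst d))) =
      (\<Sum>i=1..n. \<Sum>j=1..n. v j * (pmf (draw_pmf n) (i, j) * u i))"
    by (simp add: sum.cartesian_product case_prod_unfold)
  also have "\<dots> = (\<Sum>i=1..n. \<Sum>j=1..n. (u i * v j - (if i = j then u i * v j else 0)) / (real n * (real n - 1)))"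
    by (intro sum.cong refl) (simp add: pmf_draw_pmf[OF n])
  also have "\<dots> = (\<Sum>i=1..n. \<Sum>j=1..n. u i * v j - (if i = j then u i * v j else 0)) / (real n * (real n - 1))"
    by (simp only: sum_divide_distrib)
  also have "(\<Sum>i=1..n. \<Sum>j=1..n. u i * v j - (if i = j then u i * v j else 0)) =
      (\<Sum>i=1..n. u i) * (\<Sum>i=1..n. v i) - (\<Sum>i=1..n. u i * v i)"
    by (simp add: sum_subtractf sum_product)
  finally show ?thesis .
qed

theorem theorem2p1:
  fixes n :: nat and W :: "nat \<Rightarrow> real"
    and M :: "'a measure" and D :: "'a \<Rightarrow> nat \<times> nat"
    and X U r :: "'a \<Rightarrow> real" and m :: real
  assumes n: "n \<ge> 2"
    and W_range: "\<forall>i\<in>{1..n}. 0 < W i \<and> W i < 1"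
    and W_mono: "strict_mono_on {1..n} W"
    and m: "m = (\<Sum>i=1..n. W i) / real n"
    and M: "prob_space M"
    and D_meas: "D \<in> measurable M (count_space UNIV)"
    and r_meas: "r \<in> borel_measurable M"
    and indep: "prob_space.indep_set M
       (sets (vimage_algebra (space M) D (count_space UNIV)))
       (sets (vimage_algebra (space M) r borel))"
    and D_law: "distr M (count_space UNIV) D = measure_pmf (draw_pmf n)"
    and r_law: "distr M borel r = uniform_measure lborel {0<..<1}"
    and X: "X = (\<lambda>\<omega>. W (fst (D \<omega>)))"
    and U: "U = (\<lambda>\<omega>. W (snd (D \<omega>)))"
  shows "assign_expect M U (assigned_A M X r) < m \<and> m < assign_expect M U (assigned_B M X r)"
proof -
  interpret prob_space M by (rule M)
  let ?S = "{1..n} \<times> {1..n}"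
  let ?N = "real n * (real n - 1)"
  have supp: "set_pmf (draw_pmf n) \<subseteq> ?S"
    using pmf_draw_pmf[OF n] by (force simp: set_pmf_iff split: if_splits)
  note int = integral_indep_discrete[OF D_meas r_meas indep D_law _ supp, unfolded r_law]
  have N: "?N > 0"
    using n by simp
  \<comment> \<open>Keeps the index set in the form \<open>{1..n}\<close> instead of
    \<open>{Suc 0..n}\<close>, so that the sums below match.\<close>
  note One_nat_def [simp del]
  have sum_W: "(\<Sum>i=1..n. W i) = n * m"
    using n by (simp add: m)
  define Q where "Q = (\<Sum>i=1..n. (W i)\<^sup>2)"
  \<comment> \<open>The two lightest marbles witness that the weights are not constant.\<close>
  have "W 1 \<noteq> W 2"
    using strict_mono_onD[OF W_mono, of 1 2] n by simp
  then have Q: "n * m\<^sup>2 < Q"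
    unfolding Q_def using sum_squares_gt_mean[of "{1..n}" m W 1 2] n m by simp
  \<comment> \<open>The bounds \<open>0 < m < 1\<close> make both assignment probabilities positive,
    so the final quotients can be cleared.\<close>
  have "(\<Sum>i=1..n. W i) > 0"
    using n W_range by (intro sum_pos) auto
  moreover have "(\<Sum>i=1..n. W i) < (\<Sum>i=1..n. 1)"
    using n W_range by (intro sum_strict_mono) auto
  ultimately have m01: "0 < m" "m < 1"
    using n by (simp_all add: m divide_less_eq)

  \<comment> \<open>Leaving \<open>v\<close> free serves two purposes: \<open>v = 1\<close> gives
    the probability and \<open>v = W\<close> the weight.\<close>
  have A: "(\<integral>\<omega>. v (snd (D \<omega>)) * indicator (assigned_A M X r) \<omega> \<partial>M) =
      (n * m * (\<Sum>i=1..n. v i) - (\<Sum>i=1..n. W i * v i)) / ?N" for v :: "nat \<Rightarrow> real"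
  proof -
    have "assigned_A M X r = {\<omega> \<in> space M. r \<omega> \<in> {..<W (fst (D \<omega>))}}"
      by (auto simp: assigned_A_def X)
    then have "(\<integral>\<omega>. v (snd (D \<omega>)) * indicator (assigned_A M X r) \<omega> \<partial>M) =
        (\<Sum>d\<in>?S. v (snd d) * (pmf (draw_pmf n) d *
          measure (uniform_measure lborel {0<..<1}) {..<W (fst d)}))"
      using int[of "\<lambda>d. {..<W (fst d)}" "\<lambda>d. v (snd d)"] by simp
    also have "\<dots> = (\<Sum>d\<in>?S. v (snd d) * (pmf (draw_pmf n) d * W (fst d)))"
      using W_range by (intro sum.cong refl) (subst measure_uniform_lessThan, auto)
    finally show ?thesis
      by (simp only: sum_times_draw_pmf[OF n] sum_W)
  qed
  \<comment> \<open>The same computation with \<open>1 - W i\<close> for \<open>W i\<close>. Using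
    the measure of the upper half-line directly avoids a separate treatment of ties.\<close>
  have B: "(\<integral>\<omega>. v (snd (D \<omega>)) * indicator (assigned_B M X r) \<omega> \<partial>M) =
      ((n - n * m) * (\<Sum>i=1..n. v i) - (\<Sum>i=1..n. (1 - W i) * v i)) / ?N" for v :: "nat \<Rightarrow> real"
  proof -
    have "assigned_B M X r = {\<omega> \<in> space M. r \<omega> \<in> {W (fst (D \<omega>))<..}}"
      by (auto simp: assigned_B_def X)
    then have "(\<integral>\<omega>. v (snd (D \<omega>)) * indicator (assigned_B M X r) \<omega> \<partial>M) =
        (\<Sum>d\<in>?S. v (snd d) * (pmf (draw_pmf n) d *
          measure (uniform_measure lborel {0<..<1}) {W (fst d)<..}))"
      using int[of "\<lambda>d. {W (fst d)<..}" "\<lambda>d. v (snd d)"] by simp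
    also have "\<dots> = (\<Sum>d\<in>?S. v (snd d) * (pmf (draw_pmf n) d * (1 - W (fst d))))"
      using W_range by (intro sum.cong refl) (subst measure_uniform_greaterThan, auto)
    also have "\<dots> = ((\<Sum>i=1..n. 1 - W i) * (\<Sum>i=1..n. v i) - (\<Sum>i=1..n. (1 - W i) * v i)) / ?N"
      by (rule sum_times_draw_pmf[OF n])
    also have "(\<Sum>i=1..n. 1 - W i) = n - n * m"
      by (simp add: sum_subtractf sum_W)
    finally show ?thesis .
  qed

  have prob_eq: "prob F = (\<integral>\<omega>. 1 * indicator F \<omega> \<partial>M)" if "F \<subseteq> space M" for F
    using that by (simp add: Int_absorb2)
  have "prob (assigned_A M X r) = (n * m * n - n * m) / ?N"
    using A[of "\<lambda>_. 1"] by (subst prob_eq) (auto simp: assigned_A_def sum_W)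
  also have "\<dots> = m"
    using n N by (subst nonzero_divide_eq_eq) (auto simp: algebra_simps)
  finally have PA: "prob (assigned_A M X r) = m" .
  have "prob (assigned_B M X r) = ((n - n * m) * n - (n - n * m)) / ?N"
    using B[of "\<lambda>_. 1"] by (subst prob_eq) (auto simp: assigned_B_def sum_W sum_subtractf)
  also have "\<dots> = 1 - m"
    using n N by (subst nonzero_divide_eq_eq) (auto simp: algebra_simps)
  finally have PB: "prob (assigned_B M X r) = 1 - m" .

  have "assign_weight M U (assigned_A M X r) = (n * m * (n * m) - Q) / ?N"
    using A[of W] by (simp add: assign_weight_def U Q_def sum_W power2_eq_square)
  \<comment> \<open>Replacing \<open>Q\<close> by its strict lower bound leaves
    \<open>n * (n - 1) * m\<^sup>2\<close> in the numerator.\<close>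
  also have "\<dots> < (n * m * (n * m) - n * m\<^sup>2) / ?N"
    using Q N by (intro divide_strict_right_mono) auto
  also have "\<dots> = m * m"
    using n N by (subst nonzero_divide_eq_eq) (auto simp: algebra_simps power2_eq_square)
  finally have less: "assign_expect M U (assigned_A M X r) < m"
    using m01 by (simp add: assign_expect_def assign_prob_def PA field_simps)

  have "(\<Sum>i=1..n. (1 - W i) * W i) = n * m - Q"
    by (simp add: Q_def sum_W sum_subtractf left_diff_distrib power2_eq_square)
  then have WB: "assign_weight M U (assigned_B M X r) = ((n - n * m) * (n * m) - (n * m - Q)) / ?N"
    using B[of W] by (simp add: assign_weight_def U sum_W)
  \<comment> \<open>The right-hand side is the formula for the weight assigned to \<open>B\<close>
    with \<open>Q\<close> replaced by \<open>n * m\<^sup>2\<close>. There \<open>Q\<close> enters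
    with a plus sign, so the bound now goes the other way.\<close>
  have "m * (1 - m) = ((n - n * m) * (n * m) - (n * m - n * m\<^sup>2)) / ?N"
    using n N by (subst nonzero_eq_divide_eq) (auto simp: algebra_simps power2_eq_square)
  also have "\<dots> < assign_weight M U (assigned_B M X r)"
    unfolding WB using Q N by (intro divide_strict_right_mono) auto
  finally have greater: "m < assign_expect M U (assigned_B M X r)"
    using m01 by (simp add: assign_expect_def assign_prob_def PB pos_less_divide_eq)
  from less greater show ?thesis ..
qed

end
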